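(* For $n\in\mathbb{Z}^+$ put $$S_n=n+\frac{1}{2}\left\lfloor\frac{\sqrt{8n+1}-1}{2}\right\rfloor^2-\frac{1}{2}\left\lfloor\frac{\sqrt{8n+1}-1}{2}\right\rfloor+1 .$$ Then Conjecture C is equivalent to the statement that $$\pi[S_n,\,S_n+\lfloor\sqrt{S_n}\rfloor-1]\ge 1\quad\text{for all } n\in\mathbb{Z}^+ .$$
   Context: Conjecture C is the following assertion: for every positive integer $m$, whenever $a_1,a_2,\ldots,a_m$ are $m$ consecutive integers with $m^2<a_1<a_2<\cdots<a_m<(m+1)^2$, at least one of $a_1,\ldots,a_m$ is a prime number. $\lfloor\cdot\rfloor$ denotes the floor function. $\pi[x,y]$ denotes the number of prime numbers in the closed interval $[x,y]$. *)

theory Defs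
  imports Complex_Main "HOL-Computational_Algebra.Primes"
begin

text \<open>The values \<open>a 1, \<dots>, a m\<close> are consecutive integers in increasing order; values of
  \<open>a\<close> outside \<open>{1..m}\<close> are irrelevant.\<close>

definition consecutive_ints :: "nat \<Rightarrow> (nat \<Rightarrow> int) \<Rightarrow> bool" where
  "consecutive_ints m a \<longleftrightarrow> (\<forall>i. 1 \<le> i \<and> i < m \<longrightarrow> a (i + 1) = a i + 1)"

definition conjecture_C :: bool where
  "conjecture_C \<longleftrightarrow>
     (\<forall>m::nat. m > 0 \<longrightarrow>
        (\<forall>a. consecutive_ints m a \<and> (int m)\<^sup>2 < a 1 \<and> a m < (int m + 1)\<^sup>2 \<longrightarrow>
           (\<exists>i\<in>{1..m}. prime (a i))))"

definition prime_count :: "real \<Rightarrow> real \<Rightarrow> nat" where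
  "prime_count x y = card {p::nat. prime p \<and> x \<le> real p \<and> real p \<le> y}"

definition S :: "nat \<Rightarrow> real" where
  "S n = real n
       + 1 / 2 * (real_of_int \<lfloor>(sqrt (8 * real n + 1) - 1) / 2\<rfloor>)\<^sup>2
       - 1 / 2 * real_of_int \<lfloor>(sqrt (8 * real n + 1) - 1) / 2\<rfloor> + 1"

end

theory Submission
  imports Defs
begin

text \<open>Write \<open>n\<close> as the \<open>m\<close>-th triangular number plus \<open>j\<close> with \<open>0 \<le> j \<le> m\<close>.
  Then the floor in \<open>S n\<close> is \<open>m\<close>, so \<open>S n = m\<^sup>2 + j + 1\<close>, whose square root has floor \<open>m\<close>
  because \<open>j \<le> m\<close>. As \<open>n\<close> varies, the intervals are thus exactly the blocks of \<open>m\<close> consecutive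
  integers strictly between \<open>m\<^sup>2\<close> and \<open>(m + 1)\<^sup>2\<close>.\<close>

text \<open>The equation is doubled so that the triangular number \<open>m * (m + 1) / 2\<close>
  appears without division. In the induction \<open>j\<close> counts up to \<open>m\<close>, then
  wraps to 0 as \<open>m\<close> increases.\<close>

lemma triangular_decomposition:
  fixes n :: nat
  obtains m j where "2 * n = m * (m + 1) + 2 * j" "j \<le> m"
proof -
  have "\<exists>m j. 2 * n = m * (m + 1) + 2 * j \<and> j \<le> m"
  proof (induction n)
    case 0
    show ?case by (intro exI[of _ 0]) simp
  next
    case (Suc n)
    then obtain m j where mj: "2 * n = m * (m + 1) + 2 * j" "j \<le> m" by blast
    show ?case
    proof (cases "j = m")
      case True
      with mj show ?thesis by (intro exI[of _ "m + 1"] exI[of _ 0]) (simp add: algebra_simps)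
    next
      case False
      with mj show ?thesis by (intro exI[of _ m] exI[of _ "j + 1"]) simp
    qed
  qed
  with that show ?thesis by blast
qed

text \<open>Since \<open>8 * n + 1 = (2 * m + 1)^2 + 8 * j\<close> and \<open>j \<le> m\<close>,
  this number lies below \<open>(2 * m + 1)^2 + 8 * (m + 1) = (2 * m + 3)^2\<close>.\<close>

lemma floor_triangular_root:
  fixes n m j :: nat
  assumes n: "2 * n = m * (m + 1) + 2 * j" and j: "j \<le> m"
  shows "\<lfloor>(sqrt (8 * real n + 1) - 1) / 2\<rfloor> = int m"
proof -
  have "2 * real n = real m * (real m + 1) + 2 * real j"
    using arg_cong[OF n, of real] by (simp add: algebra_simps)
  then have eq: "8 * real n + 1 = (2 * real m + 1)\<^sup>2 + 8 * real j"
    by (simp add: power2_eq_square algebra_simps)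
  have "2 * real m + 1 \<le> sqrt (8 * real n + 1)"
    by (rule real_le_rsqrt) (simp add: eq)
  moreover have "sqrt (8 * real n + 1) < 2 * real m + 3"
    unfolding eq
    by (rule real_less_lsqrt) (use j in \<open>simp_all add: power2_eq_square algebra_simps\<close>)
  ultimately show ?thesis by (simp add: floor_eq_iff)
qed

text \<open>With floor \<open>m\<close>, the formula adds \<open>m * (m - 1) / 2 + 1\<close> to
  \<open>n\<close>; the two triangular numbers sum to \<open>m^2\<close>.\<close>

lemma S_eq:
  assumes n: "2 * n = m * (m + 1) + 2 * j" and j: "j \<le> m"
  shows "S n = real (m\<^sup>2 + j + 1)"
proof -
  have "2 * real n = real m * (real m + 1) + 2 * real j"
    using arg_cong[OF n, of real] by (simp add: algebra_simps)
  then show ?thesis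
    unfolding S_def floor_triangular_root[OF n j]
    by (simp add: power2_eq_square algebra_simps)
qed

lemma floor_sqrt_eq:
  fixes m j :: nat
  assumes "j \<le> 2 * m"
  shows "\<lfloor>sqrt (real (m\<^sup>2 + j))\<rfloor> = int m"
proof -
  have "real m \<le> sqrt (real (m\<^sup>2 + j))"
    by (rule real_le_rsqrt) simp
  moreover have "sqrt (real (m\<^sup>2 + j)) < real m + 1"
    by (rule real_less_lsqrt) (use assms in \<open>simp_all add: power2_eq_square algebra_simps\<close>)
  ultimately show ?thesis by (simp add: floor_eq_iff)
qed

lemma prime_count_ge_1_iff:
  "prime_count x y \<ge> 1 \<longleftrightarrow> (\<exists>p::nat. prime p \<and> x \<le> real p \<and> real p \<le> y)"
proof -
  \<comment> \<open>Finiteness matters because \<open>card\<close> of an infinite set is 0.\<close>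
  have "finite {p::nat. prime p \<and> x \<le> real p \<and> real p \<le> y}"
    by (rule finite_subset[of _ "{..nat \<lfloor>y\<rfloor>}"]) (auto simp: le_nat_floor)
  then show ?thesis
    unfolding prime_count_def by (auto simp: Suc_le_eq card_gt_0_iff)
qed

lemma consecutive_ints_eq:
  assumes "consecutive_ints m a" "1 \<le> i" "i \<le> m"
  shows "a i = a 1 + int i - 1"
  using assms(2,3)
proof (induction i rule: dec_induct)
  case (step i)
  then show ?case using assms(1) by (simp add: consecutive_ints_def)
qed simp

text \<open>A block is determined by its offset \<open>j\<close> from \<open>m^2\<close>: it runs
  from \<open>m^2 + j + 1\<close> to \<open>m^2 + j + m\<close>, and its last element is below
  \<open>(m + 1)^2\<close> exactly when \<open>j \<le> m\<close>.\<close>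

lemma conjecture_C_iff:
  "conjecture_C \<longleftrightarrow>
    (\<forall>m j. 0 < m \<and> j \<le> m \<longrightarrow> (\<exists>p::nat. prime p \<and> m\<^sup>2 + j + 1 \<le> p \<and> p \<le> m\<^sup>2 + j + m))"
    (is "_ \<longleftrightarrow> ?R")
proof
  assume C: conjecture_C
  show ?R
  proof (intro allI impI)
    fix m j :: nat
    assume mj: "0 < m \<and> j \<le> m"
    define a where "a i = int (m\<^sup>2 + j + i)" for i
    have "consecutive_ints m a" "(int m)\<^sup>2 < a 1" "a m < (int m + 1)\<^sup>2"
      using mj by (auto simp: consecutive_ints_def a_def power2_eq_square algebra_simps)
    with C mj obtain i where "i \<in> {1..m}" "prime (a i)"
      unfolding conjecture_C_def by blast
    then show "\<exists>p::nat. prime p \<and> m\<^sup>2 + j + 1 \<le> p \<and> p \<le> m\<^sup>2 + j + m"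
      unfolding a_def prime_nat_int_transfer by (intro exI[of _ "m\<^sup>2 + j + i"]) simp
  qed
next
  assume R: ?R
  show conjecture_C
    unfolding conjecture_C_def
  proof (intro allI impI, elim conjE)
    fix m :: nat and a
    assume m: "m > 0" and a: "consecutive_ints m a"
      and lower: "(int m)\<^sup>2 < a 1" and upper: "a m < (int m + 1)\<^sup>2"
    \<comment> \<open>The argument of \<open>nat\<close> is nonnegative by \<open>lower\<close>, so
      nothing is truncated.\<close>
    define j where "j = nat (a 1 - (int m)\<^sup>2 - 1)"
    have a1: "a 1 = int (m\<^sup>2 + j + 1)"
      using lower by (simp add: j_def)
    have "a m = int (m\<^sup>2 + j + m)"
      using consecutive_ints_eq[OF a, of m] m a1 by simp
    then have "j \<le> m"
      using upper by (simp add: power2_eq_square algebra_simps)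
    with R m obtain p :: nat where p: "prime p" "m\<^sup>2 + j + 1 \<le> p" "p \<le> m\<^sup>2 + j + m"
      by blast
    define i where "i = p - (m\<^sup>2 + j)"
    have i: "i \<in> {1..m}"
      using p by (auto simp: i_def)
    then have "a i = int p"
      using consecutive_ints_eq[OF a, of i] a1 p by (simp add: i_def)
    with p(1) have "prime (a i)" by simp
    with i show "\<exists>i\<in>{1..m}. prime (a i)" by blast
  qed
qed

lemma prime_count_S_iff:
  assumes n: "2 * n = m * (m + 1) + 2 * j" and j: "j \<le> m" and m: "0 < m"
  shows "prime_count (S n) (S n + real_of_int \<lfloor>sqrt (S n)\<rfloor> - 1) \<ge> 1 \<longleftrightarrow>
    (\<exists>p::nat. prime p \<and> m\<^sup>2 + j + 1 \<le> p \<and> p \<le> m\<^sup>2 + j + m)"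
proof -
  have S: "S n = real (m\<^sup>2 + j + 1)"
    by (rule S_eq[OF n j])
  \<comment> \<open>The required bound \<open>j + 1 \<le> 2 * m\<close> follows from
    \<open>j \<le> m\<close> and \<open>0 < m\<close>.\<close>
  have "\<lfloor>sqrt (S n)\<rfloor> = int m"
    using floor_sqrt_eq[of "j + 1" m] j m by (simp add: S add.assoc)
  then have "S n + real_of_int \<lfloor>sqrt (S n)\<rfloor> - 1 = real (m\<^sup>2 + j + m)"
    by (simp add: S)
  then show ?thesis
    by (simp only: S prime_count_ge_1_iff of_nat_le_iff)
qed

theorem theorem5p10:
  shows "conjecture_C \<longleftrightarrow>
    (\<forall>n::nat. n > 0 \<longrightarrow> prime_count (S n) (S n + real_of_int \<lfloor>sqrt (S n)\<rfloor> - 1) \<ge> 1)"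
  unfolding conjecture_C_iff
proof (intro iffI allI impI)
  fix n :: nat
  assume R: "\<forall>m j. 0 < m \<and> j \<le> m \<longrightarrow>
      (\<exists>p::nat. prime p \<and> m\<^sup>2 + j + 1 \<le> p \<and> p \<le> m\<^sup>2 + j + m)"
    and "n > 0"
  obtain m j where mj: "2 * n = m * (m + 1) + 2 * j" "j \<le> m"
    by (rule triangular_decomposition)
  \<comment> \<open>\<open>m = 0\<close> would force \<open>j = 0\<close> and hence
    \<open>n = 0\<close>.\<close>
  with \<open>n > 0\<close> have "0 < m" by (cases m) auto
  with R mj show "prime_count (S n) (S n + real_of_int \<lfloor>sqrt (S n)\<rfloor> - 1) \<ge> 1"
    using prime_count_S_iff by blast
next
  fix m j :: nat
  assume L: "\<forall>n::nat. n > 0 \<longrightarrow>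
      prime_count (S n) (S n + real_of_int \<lfloor>sqrt (S n)\<rfloor> - 1) \<ge> 1"
    and mj: "0 < m \<and> j \<le> m"
  \<comment> \<open>The division is exact because \<open>m * (m + 1)\<close> is even.\<close>
  define n where "n = m * (m + 1) div 2 + j"
  have n: "2 * n = m * (m + 1) + 2 * j"
    by (simp add: n_def)
  with mj have "0 < m * (m + 1)" by simp
  with n have "n > 0" by linarith
  with L n mj show "\<exists>p::nat. prime p \<and> m\<^sup>2 + j + 1 \<le> p \<and> p \<le> m\<^sup>2 + j + m"
    using prime_count_S_iff by blast
qed

end
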